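(* Let $\{\mathbf{x}^{k}\}$ be a sequence generated by the algorithm FBi-PG (defined in the context, with $t_k=(k+a)/a$ for $k\ge 0$ and an integer $a\ge 2$) with $\gamma\in(0,2)$. Then for all integers $k\ge 1$ and all $\mathbf{x}'\in X'$, $$\min_{1\le s\le k}\omega(\mathbf{x}^{s})-\omega(\mathbf{x}')\le \frac{a^{2}\beta}{2(k+1)^{2-\gamma}}\|\mathbf{x}^{0}-\mathbf{x}'\|^{2}.$$
   Context: Bi-level problem: the inner problem is $\min_{\mathbf{x}\in\mathbb{R}^n}\{\varphi(\mathbf{x}):=f(\mathbf{x})+g(\mathbf{x})\}$ with solution set $X^{\ast}$; the outer problem is $\min_{\mathbf{x}\in X^{\ast}}\{\omega(\mathbf{x}):=\sigma(\mathbf{x})+\psi(\mathbf{x})\}$, and $X'\subset X^{\ast}$ is the set of its optimal solutions (minimizers of $\omega$ over $X^\ast$, at which $\omega$ is finite). Standing assumptions: (i) $f,\sigma:\mathbb{R}^n\to\mathbb{R}$ are convex and continuously differentiable with Lipschitz continuous gradients with constants $\beta_f,\beta_\sigma$, and $\beta:=\beta_f+\beta_\sigma>0$; (ii) $g,\psi:\mathbb{R}^n\to(-\infty,\infty]$ are proper, lower semicontinuous and convex; (iii) $X^{\ast}\ne\emptyset$; (iv) $\omega^{\ast}:=\inf_{\mathbf{x}\in\mathbb{R}^n}\omega(\mathbf{x})>-\infty$. Norms are Euclidean. Algorithm FBi-PG: input $\gamma>0$ and an integer $a\ge 2$. Set $\alpha_{-1}=t_{-1}=0$, $\mathbf{x}^{0}=\mathbf{x}^{-1}\in\mathbb{R}^n$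 arbitrary, and for $k\ge0$ let $\alpha_k=(k+a)^{-\gamma}$, $t_k=(k+a)/a$, $f_k=f+\alpha_k\sigma$, $g_k=g+\alpha_k\psi$. For $k=0,1,2,\ldots$: $$\mathbf{y}^{k}=\mathbf{x}^{k}+t_k^{-1}(t_{k-1}-1)(\mathbf{x}^{k}-\mathbf{x}^{k-1}),\qquad \mathbf{x}^{k+1}=\operatorname*{arg\,min}_{\mathbf{x}\in\mathbb{R}^n}\Bigl\{g_k(\mathbf{x})+\mathbf{x}^{T}\nabla f_k(\mathbf{y}^{k})+\tfrac{\beta}{2}\|\mathbf{x}-\mathbf{y}^{k}\|^{2}\Bigr\}.$$ *)

theory Defs
  imports "HOL-Analysis.Analysis"
begin

text \<open>Only meaningful at points of differentiability; there it is the unique \<open>D\<close>, see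
  \<open>gradient_eqI\<close> and \<open>gradient_works\<close> below.\<close>

definition gradient :: "(real ^ 'n \<Rightarrow> real) \<Rightarrow> real ^ 'n \<Rightarrow> real ^ 'n" where
  "gradient h x = (THE D. GDERIV h x :> D)"

definition continuously_differentiable :: "(real ^ 'n \<Rightarrow> real) \<Rightarrow> bool" where
  "continuously_differentiable h \<longleftrightarrow>
     (\<forall>x. h differentiable (at x)) \<and> continuous_on UNIV (gradient h)"

text \<open>Functions with values in \<open>(-\<infinity>, \<infinity>]\<close> are modelled as \<^typ>\<open>ereal\<close>-valued functions;
  \<open>proper\<close> includes that \<open>-\<infinity>\<close> is not attained.\<close>

definition proper :: "('a \<Rightarrow> ereal) \<Rightarrow> bool" where
  "proper h \<longleftrightarrow> (\<forall>x. h x \<noteq> -\<infinity>) \<and> (\<exists>x. h x \<noteq> \<infinity>)"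

definition lower_semicontinuous :: "('a::topological_space \<Rightarrow> ereal) \<Rightarrow> bool" where
  "lower_semicontinuous h \<longleftrightarrow> (\<forall>x. h x \<le> Liminf (at x) h)"

text \<open>Used for functions that avoid \<open>-\<infinity>\<close> only. In \<^typ>\<open>ereal\<close> we have \<open>0 * \<infinity> = 0\<close>, so
  the cases \<open>u = 0\<close> and \<open>v = 0\<close> hold trivially.\<close>

definition ereal_convex :: "('a::real_vector \<Rightarrow> ereal) \<Rightarrow> bool" where
  "ereal_convex h \<longleftrightarrow> (\<forall>x y. \<forall>u\<ge>0. \<forall>v\<ge>0. u + v = 1 \<longrightarrow>
     h (u *\<^sub>R x + v *\<^sub>R y) \<le> ereal u * h x + ereal v * h y)"

definition composite :: "('a \<Rightarrow> real) \<Rightarrow> ('a \<Rightarrow> ereal) \<Rightarrow> 'a \<Rightarrow> ereal" where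
  "composite h p x = ereal (h x) + p x"

definition inner_solutions :: "('a \<Rightarrow> ereal) \<Rightarrow> 'a set" where
  "inner_solutions \<phi> = {x. is_arg_min \<phi> (\<lambda>_. True) x}"

definition outer_solutions :: "('a \<Rightarrow> ereal) \<Rightarrow> ('a \<Rightarrow> ereal) \<Rightarrow> 'a set" where
  "outer_solutions \<phi> \<omega> =
     {x. is_arg_min \<omega> (\<lambda>z. z \<in> inner_solutions \<phi>) x \<and> \<bar>\<omega> x\<bar> \<noteq> \<infinity>}"

text \<open>Iteration counters are integers because the scheme starts from index \<open>-1\<close>.\<close>

definition reg_param :: "real \<Rightarrow> int \<Rightarrow> int \<Rightarrow> real" where
  "reg_param \<gamma> a k = (if k = -1 then 0 else real_of_int (k + a) powr (- \<gamma>))"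

definition momentum :: "int \<Rightarrow> int \<Rightarrow> real" where
  "momentum a k = (if k = -1 then 0 else real_of_int (k + a) / real_of_int a)"

definition smooth_part ::
  "real \<Rightarrow> int \<Rightarrow> ('a \<Rightarrow> real) \<Rightarrow> ('a \<Rightarrow> real) \<Rightarrow> int \<Rightarrow> 'a \<Rightarrow> real" where
  "smooth_part \<gamma> a f \<sigma> k z = f z + reg_param \<gamma> a k * \<sigma> z"

definition nonsmooth_part ::
  "real \<Rightarrow> int \<Rightarrow> ('a \<Rightarrow> ereal) \<Rightarrow> ('a \<Rightarrow> ereal) \<Rightarrow> int \<Rightarrow> 'a \<Rightarrow> ereal" where
  "nonsmooth_part \<gamma> a g \<psi> k z = g z + ereal (reg_param \<gamma> a k) * \<psi> z"

text \<open>\<open>x\<close> and \<open>y\<close> are sequences generated by FBi-PG from the starting point \<open>x 0\<close>; their values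
  at indices below \<open>-1\<close> and \<open>0\<close>, respectively, are irrelevant.\<close>

definition FBi_PG ::
  "real \<Rightarrow> real \<Rightarrow> int \<Rightarrow> (real ^ 'n \<Rightarrow> real) \<Rightarrow> (real ^ 'n \<Rightarrow> ereal) \<Rightarrow>
   (real ^ 'n \<Rightarrow> real) \<Rightarrow> (real ^ 'n \<Rightarrow> ereal) \<Rightarrow>
   (int \<Rightarrow> real ^ 'n) \<Rightarrow> (int \<Rightarrow> real ^ 'n) \<Rightarrow> bool" where
  "FBi_PG \<beta> \<gamma> a f g \<sigma> \<psi> x y \<longleftrightarrow>
     x 0 = x (-1) \<and>
     (\<forall>k\<ge>0.
        y k = x k + (inverse (momentum a k) * (momentum a (k - 1) - 1)) *\<^sub>R (x k - x (k - 1)) \<and>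
        is_arg_min
          (\<lambda>z. nonsmooth_part \<gamma> a g \<psi> k z
               + ereal (z \<bullet> gradient (smooth_part \<gamma> a f \<sigma> k) (y k) + \<beta> / 2 * (norm (z - y k))\<^sup>2))
          (\<lambda>_. True) (x (k + 1)))"

lemma gradient_eqI:
  assumes "GDERIV h x :> D"
  shows "gradient h x = D"
  unfolding gradient_def
proof (rule the_equality)
  show "GDERIV h x :> D" by (rule assms)
next
  fix E assume "GDERIV h x :> E"
  then have "((h has_derivative (\<lambda>v. inner v E)) (at x))"
    by (simp only: gderiv_def)
  moreover have "((h has_derivative (\<lambda>v. inner v D)) (at x))"
    using assms by (simp only: gderiv_def)
  ultimately have "(\<lambda>v. inner v E) = (\<lambda>v. inner v D)"
    by (rule has_derivative_unique)
  then have "inner (E - D) E = inner (E - D) D"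
    by (rule fun_cong)
  then have "inner (E - D) (E - D) = 0"
    by (simp only: inner_diff_right)
  then show "E = D"
    by simp
qed

lemma gradient_works:
  assumes "h differentiable (at x)"
  shows "GDERIV h x :> gradient h x"
proof -
  obtain h' where h': "(h has_derivative h') (at x)"
    using assms unfolding differentiable_def by blast
  then have lin: "linear h'"
    by (rule has_derivative_linear)
  have "h' v = inner v (adjoint h' 1)" for v
    using adjoint_works[OF lin, of v 1] by simp
  then have "h' = (\<lambda>v. inner v (adjoint h' 1))"
    by (rule ext)
  with h' have "(h has_derivative (\<lambda>v. inner v (adjoint h' 1))) (at x)"
    by (rule back_subst[where P = "\<lambda>d. (h has_derivative d) (at x)"])
  then have deriv: "GDERIV h x :> adjoint h' 1"
    by (simp only: gderiv_def)
  show ?thesis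
    unfolding gradient_eqI[OF deriv] by (rule deriv)
qed

end

theory Submission
  imports Defs
begin

text \<open>Each iteration is one accelerated proximal gradient (FISTA) step for the regularized
  objective \<open>\<phi> + \<alpha>\<^sub>j \<omega>\<close>, so the usual FISTA estimate holds, with weights \<open>t\<^sub>j\<close>
  (lemma \<open>accelerated_step\<close>). With \<open>\<Phi>\<close> and \<open>\<Omega>\<close> the gaps of \<open>\<phi>\<close> and \<open>\<omega>\<close> to their values
  at \<open>x'\<close>, it reads
  \<open>t\<^sub>j\<^sup>2 (\<Phi>\<^bsub>j+1\<^esub> + \<alpha>\<^sub>j \<Omega>\<^bsub>j+1\<^esub>) - (t\<^sub>j\<^sup>2 - t\<^sub>j) (\<Phi>\<^sub>j + \<alpha>\<^sub>j \<Omega>\<^sub>j) \<le> \<beta>/2 (E\<^sub>j - E\<^bsub>j+1\<^esub>)\<close>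
  for a potential \<open>E \<ge> 0\<close> with \<open>E\<^sub>0 = \<parallel>x\<^sub>0 - x'\<parallel>\<^sup>2\<close>.

  Summing the right-hand sides leaves at most \<open>\<beta>/2 \<parallel>x\<^sub>0 - x'\<parallel>\<^sup>2\<close>. On the left, collect the
  terms that belong to the same iterate. The gap \<open>\<Phi>\<close> is nonnegative because \<open>x'\<close> minimizes
  \<open>\<phi>\<close>, and its coefficients \<open>t\<^bsub>j-1\<^esub>\<^sup>2 - (t\<^sub>j\<^sup>2 - t\<^sub>j)\<close> are nonnegative, so it can be dropped.
  The gap \<open>\<Omega>\<close> may be negative, since an iterate need not minimize \<open>\<phi>\<close>, but its
  coefficients are nonnegative as well, because \<open>\<alpha>\<close> decreases; hence each \<open>\<Omega>\<^sub>j\<close> can be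
  replaced by the smallest one. This is why the theorem speaks of the best iterate.
  The coefficients add up to \<open>\<Sum> \<alpha>\<^sub>j t\<^sub>j\<close> (lemma \<open>weighted_telescoping\<close>), which here is
  \<open>1/a \<Sum> (j + a)\<^bsup>1-\<gamma>\<^esup>\<close>. Comparing this sum with the increments of a power
  (lemma \<open>sum_powr_ge\<close>) shows that it is at least \<open>(k + 1)\<^bsup>2-\<gamma>\<^esup> / a\<^sup>2\<close>, and dividing by it
  gives the bound.\<close>

section \<open>Convex functions with Lipschitz continuous gradient\<close>

lemma GDERIV_along_line:
  assumes "\<And>x. GDERIV h x :> G x"
  shows "((\<lambda>s. h (y + s *\<^sub>R d)) has_real_derivative (d \<bullet> G (y + s *\<^sub>R d))) (at s within S)"
proof -
  have "(h has_derivative (\<lambda>v. v \<bullet> G (y + s *\<^sub>R d))) (at (y + s *\<^sub>R d))"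
    using assms by (simp add: gderiv_def)
  moreover have "((\<lambda>s. y + s *\<^sub>R d) has_derivative (\<lambda>v. v *\<^sub>R d)) (at s within S)"
    by (auto intro!: derivative_eq_intros)
  ultimately have "((\<lambda>s. h (y + s *\<^sub>R d)) has_derivative (\<lambda>v. (v *\<^sub>R d) \<bullet> G (y + s *\<^sub>R d))) (at s within S)"
    by (rule has_derivative_compose[rotated])
  then show ?thesis
    by (simp add: has_field_derivative_def mult_commute_abs)
qed

lemma convex_above_tangent:
  fixes h :: "'a::real_inner \<Rightarrow> real"
  assumes cvx: "convex_on UNIV h" and G: "\<And>x. GDERIV h x :> G x"
  shows "h y + (z - y) \<bullet> G y \<le> h z"
proof -
  define r where "r s = h (y + s *\<^sub>R (z - y))" for s
  have "convex_on UNIV r"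
  proof (rule convex_onI)
    fix t u v :: real assume "0 < t" "t < 1"
    moreover have "y + ((1 - t) * u + t * v) *\<^sub>R (z - y)
        = (1 - t) *\<^sub>R (y + u *\<^sub>R (z - y)) + t *\<^sub>R (y + v *\<^sub>R (z - y))"
      by (simp add: algebra_simps)
    ultimately show "r ((1 - t) *\<^sub>R u + t *\<^sub>R v) \<le> (1 - t) * r u + t * r v"
      unfolding r_def using convex_onD[OF cvx, of t] by simp
  qed simp
  moreover have "(r has_real_derivative ((z - y) \<bullet> G y)) (at 0)"
    unfolding r_def using GDERIV_along_line[OF G, where s = 0] by simp
  ultimately have "r 1 - r 0 \<ge> ((z - y) \<bullet> G y) * (1 - 0)"
    by (intro convex_on_imp_above_tangent[where A = UNIV]) auto
  then show ?thesis
    by (simp add: r_def)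
qed

text \<open>Along the segment from \<open>y\<close> to \<open>z\<close>, the derivative of \<open>h\<close> exceeds its initial value by at
  most \<open>s L \<parallel>z - y\<parallel>\<^sup>2\<close>; subtracting the quadratic with exactly this growth leaves a nonincreasing
  function.\<close>

lemma descent_lemma:
  fixes h :: "'a::real_inner \<Rightarrow> real"
  assumes G: "\<And>x. GDERIV h x :> G x" and lip: "L-lipschitz_on UNIV G"
  shows "h z \<le> h y + (z - y) \<bullet> G y + L / 2 * (norm (z - y))\<^sup>2"
proof -
  define d where "d = z - y"
  define r where "r s = h (y + s *\<^sub>R d) - s * (d \<bullet> G y) - L / 2 * s\<^sup>2 * (norm d)\<^sup>2" for s
  have "r 1 \<le> r 0"
  proof (rule DERIV_nonpos_imp_nonincreasing[where f = r])
    fix s :: real assume s: "0 \<le> s" "s \<le> 1"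
    have "(r has_real_derivative
        (d \<bullet> G (y + s *\<^sub>R d) - d \<bullet> G y - L * s * (norm d)\<^sup>2)) (at s)"
      unfolding r_def
      by (rule derivative_eq_intros GDERIV_along_line[OF G] refl | simp)+
    moreover have "d \<bullet> G (y + s *\<^sub>R d) - d \<bullet> G y \<le> L * s * (norm d)\<^sup>2"
    proof -
      have "d \<bullet> (G (y + s *\<^sub>R d) - G y) \<le> norm d * norm (G (y + s *\<^sub>R d) - G y)"
        by (rule norm_cauchy_schwarz)
      also have "\<dots> \<le> norm d * (L * (s * norm d))"
        using lipschitz_onD[OF lip, of "y + s *\<^sub>R d" y] s
        by (intro mult_left_mono) (simp_all add: dist_norm)
      finally show ?thesis
        by (simp add: inner_diff_right power2_eq_square mult_ac)
    qed
    ultimately show "\<exists>D. (r has_real_derivative D) (at s) \<and> D \<le> 0"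
      by fastforce
  qed simp
  then show ?thesis
    by (simp add: r_def d_def)
qed

section \<open>The accelerated proximal gradient step\<close>

lemma norm_sq_convex_combination:
  fixes u v :: "'a::real_inner"
  shows "(norm ((1 - \<theta>) *\<^sub>R u + \<theta> *\<^sub>R v))\<^sup>2
    = (1 - \<theta>) * (norm u)\<^sup>2 + \<theta> * (norm v)\<^sup>2 - \<theta> * (1 - \<theta>) * (norm (v - u))\<^sup>2"
  unfolding power2_norm_eq_inner
  by (simp add: inner_add_left inner_add_right inner_diff_left inner_diff_right inner_commute[of v u] algebra_simps)

text \<open>The quadratic term sharpens the convexity inequality of the minimized function by
  \<open>\<beta>/2 \<theta> (1 - \<theta>) \<parallel>z - w\<parallel>\<^sup>2\<close> at the point \<open>(1 - \<theta>) w + \<theta> z\<close>. Since \<open>w\<close> is a minimizer, its value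
  is at most the value there; divide by \<open>\<theta>\<close> and let \<open>\<theta>\<close> tend to \<open>0\<close>.\<close>

lemma prox_three_point:
  fixes p :: "'a::real_inner \<Rightarrow> ereal"
  assumes cvx: "ereal_convex p" and p: "\<And>z. p z \<noteq> -\<infinity>"
    and min: "is_arg_min (\<lambda>z. p z + ereal (z \<bullet> c + \<beta> / 2 * (norm (z - y))\<^sup>2)) (\<lambda>_. True) w"
    and fin: "p z \<noteq> \<infinity>"
  shows "p w \<noteq> \<infinity>"
    and "real_of_ereal (p w) + w \<bullet> c + \<beta> / 2 * (norm (w - y))\<^sup>2 + \<beta> / 2 * (norm (z - w))\<^sup>2
      \<le> real_of_ereal (p z) + z \<bullet> c + \<beta> / 2 * (norm (z - y))\<^sup>2"
proof -
  define q where "q v = v \<bullet> c + \<beta> / 2 * (norm (v - y))\<^sup>2" for v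
  have min': "p w + ereal (q w) \<le> p v + ereal (q v)" for v
    using min unfolding is_arg_min_def q_def by (simp add: not_less)
  obtain pz where pz: "p z = ereal pz"
    using p fin by (cases "p z") auto
  show "p w \<noteq> \<infinity>"
    using min'[of z] pz by auto
  then obtain pw where pw: "p w = ereal pw"
    using p by (cases "p w") auto
  have "pw + q w + (1 - \<theta>) * (\<beta> / 2 * (norm (z - w))\<^sup>2) \<le> pz + q z" if \<theta>: "0 < \<theta>" "\<theta> < 1" for \<theta>
  proof -
    define v where "v = (1 - \<theta>) *\<^sub>R w + \<theta> *\<^sub>R z"
    have "p v \<le> ereal (1 - \<theta>) * p w + ereal \<theta> * p z"
      using cvx \<theta> unfolding ereal_convex_def v_def by simp
    then have "p v \<le> ereal ((1 - \<theta>) * pw + \<theta> * pz)"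
      by (simp add: pw pz)
    with min'[of v] p[of v] have "pw + q w \<le> (1 - \<theta>) * pw + \<theta> * pz + q v"
      by (cases "p v") (auto simp: pw)
    moreover have "q v = (1 - \<theta>) * q w + \<theta> * q z - \<theta> * (1 - \<theta>) * (\<beta> / 2 * (norm (z - w))\<^sup>2)"
    proof -
      have "v - y = (1 - \<theta>) *\<^sub>R (w - y) + \<theta> *\<^sub>R (z - y)"
        by (simp add: v_def algebra_simps)
      then have "(norm (v - y))\<^sup>2 = (1 - \<theta>) * (norm (w - y))\<^sup>2 + \<theta> * (norm (z - y))\<^sup>2
          - \<theta> * (1 - \<theta>) * (norm (z - w))\<^sup>2"
        using norm_sq_convex_combination[of \<theta> "w - y" "z - y"] by simp
      moreover have "v \<bullet> c = (1 - \<theta>) * (w \<bullet> c) + \<theta> * (z \<bullet> c)"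
        by (simp add: v_def inner_add_left)
      ultimately show ?thesis
        unfolding q_def by (simp only:) (simp add: field_simps)
    qed
    ultimately have "\<theta> * (pw + q w + (1 - \<theta>) * (\<beta> / 2 * (norm (z - w))\<^sup>2)) \<le> \<theta> * (pz + q z)"
      by (simp add: algebra_simps)
    then show ?thesis
      using \<theta> by simp
  qed
  then have "\<forall>\<^sub>F \<theta> in at_right 0.
      pw + q w + (1 - \<theta>) * (\<beta> / 2 * (norm (z - w))\<^sup>2) \<le> pz + q z"
    using eventually_at_right_less eventually_at_right_real[of 0 1]
    by (auto elim: eventually_mono)
  moreover have "((\<lambda>\<theta>. pw + q w + (1 - \<theta>) * (\<beta> / 2 * (norm (z - w))\<^sup>2))
      \<longlongrightarrow> pw + q w + (1 - 0) * (\<beta> / 2 * (norm (z - w))\<^sup>2)) (at_right (0::real))"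
    by (intro tendsto_intros)
  ultimately have "pw + q w + (1 - 0) * (\<beta> / 2 * (norm (z - w))\<^sup>2) \<le> pz + q z"
    by (intro tendsto_upperbound) auto
  then show "real_of_ereal (p w) + w \<bullet> c + \<beta> / 2 * (norm (w - y))\<^sup>2 + \<beta> / 2 * (norm (z - w))\<^sup>2
      \<le> real_of_ereal (p z) + z \<bullet> c + \<beta> / 2 * (norm (z - y))\<^sup>2"
    by (simp add: pw pz q_def)
qed

text \<open>The descent lemma bounds \<open>h w\<close> from above and convexity bounds \<open>h z\<close> from below, both by the
  linearization of \<open>h\<close> at \<open>y\<close>, which is the linear term of the proximal subproblem.\<close>

lemma prox_grad_inequality:
  fixes h :: "'a::real_inner \<Rightarrow> real" and p :: "'a \<Rightarrow> ereal"
  assumes h: "convex_on UNIV h" "\<And>x. GDERIV h x :> G x" "\<beta>-lipschitz_on UNIV G"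
    and cvx: "ereal_convex p" and p: "\<And>z. p z \<noteq> -\<infinity>"
    and min: "is_arg_min (\<lambda>z. p z + ereal (z \<bullet> G y + \<beta> / 2 * (norm (z - y))\<^sup>2)) (\<lambda>_. True) w"
    and fin: "p z \<noteq> \<infinity>"
  shows "h w + real_of_ereal (p w) + \<beta> / 2 * (norm (z - w))\<^sup>2
    \<le> h z + real_of_ereal (p z) + \<beta> / 2 * (norm (z - y))\<^sup>2"
  using descent_lemma[OF h(2,3), of w y] convex_above_tangent[OF h(1,2), of y z]
    prox_three_point(2)[OF cvx p min fin]
  by (simp add: inner_diff_left)

text \<open>The proximal gradient inequality is used at the point \<open>z = (1 - 1/t) x + (1/t) x'\<close> and
  multiplied by \<open>t\<^sup>2\<close>. Convexity then splits the value at \<open>z\<close> between \<open>x\<close> and \<open>x'\<close>, and the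
  distances to \<open>z\<close> become norms of combinations that telescope under the momentum rule. For
  \<open>t = 1\<close> the point \<open>x\<close> has weight \<open>0\<close> and may lie outside the domain of \<open>p\<close>; this case is
  required for the first step, whose starting point is arbitrary.\<close>

lemma accelerated_step:
  fixes h :: "'a::real_inner \<Rightarrow> real" and p :: "'a \<Rightarrow> ereal"
  assumes h: "convex_on UNIV h" "\<And>x. GDERIV h x :> G x" "\<beta>-lipschitz_on UNIV G"
    and cvx: "ereal_convex p" and p: "\<And>z. p z \<noteq> -\<infinity>"
    and min: "is_arg_min (\<lambda>z. p z + ereal (z \<bullet> G y + \<beta> / 2 * (norm (z - y))\<^sup>2)) (\<lambda>_. True) w"
    and t: "t \<ge> 1" and x: "t = 1 \<or> p x \<noteq> \<infinity>" and x': "p x' \<noteq> \<infinity>"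
  defines "F \<equiv> \<lambda>z. h z + real_of_ereal (p z)"
  shows "t\<^sup>2 * (F w - F x') - (t\<^sup>2 - t) * (F x - F x')
    \<le> \<beta> / 2 * ((norm (t *\<^sub>R y - (t - 1) *\<^sub>R x - x'))\<^sup>2 - (norm (t *\<^sub>R w - (t - 1) *\<^sub>R x - x'))\<^sup>2)"
proof -
  define z where "z = (1 - 1 / t) *\<^sub>R x + (1 / t) *\<^sub>R x'"
  have pos: "t > 0" using t by simp
  have z: "p z \<noteq> \<infinity> \<and> t * F z \<le> (t - 1) * F x + F x'"
  proof (cases "t = 1")
    case True
    then show ?thesis using x' by (simp add: z_def)
  next
    case False
    then obtain px px' where px: "p x = ereal px" "p x' = ereal px'"
      using x x' p by (cases "p x"; cases "p x'") auto
    have "p z \<le> ereal (1 - 1 / t) * p x + ereal (1 / t) * p x'"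
      using cvx t unfolding ereal_convex_def z_def by simp
    then obtain pz where pz: "p z = ereal pz" "pz \<le> (1 - 1 / t) * px + 1 / t * px'"
      using p[of z] by (cases "p z") (auto simp: px)
    have "h z \<le> (1 - 1 / t) * h x + 1 / t * h x'"
      using convex_onD[OF h(1), of "1 / t" x x'] t by (simp add: z_def)
    with pz(2) have "h z + pz \<le> (1 - 1 / t) * (h x + px) + 1 / t * (h x' + px')"
      by (simp add: algebra_simps)
    then have "t * (h z + pz) \<le> t * ((1 - 1 / t) * (h x + px) + 1 / t * (h x' + px'))"
      using pos by (intro mult_left_mono) auto
    also have "\<dots> = (t - 1) * (h x + px) + (h x' + px')"
      using pos by (simp add: field_simps)
    finally show ?thesis
      by (simp add: F_def px pz(1))
  qed
  have scale: "t\<^sup>2 * (norm (z - v))\<^sup>2 = (norm (t *\<^sub>R v - (t - 1) *\<^sub>R x - x'))\<^sup>2" for v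
  proof -
    have "t *\<^sub>R v - (t - 1) *\<^sub>R x - x' = t *\<^sub>R (v - z)"
      using pos by (simp add: z_def algebra_simps)
    then show ?thesis
      by (simp add: power_mult_distrib norm_minus_commute)
  qed
  have "F w + \<beta> / 2 * (norm (z - w))\<^sup>2 \<le> F z + \<beta> / 2 * (norm (z - y))\<^sup>2"
    unfolding F_def using z prox_grad_inequality[OF h cvx p min] by blast
  then have "t\<^sup>2 * (F w + \<beta> / 2 * (norm (z - w))\<^sup>2) \<le> t\<^sup>2 * (F z + \<beta> / 2 * (norm (z - y))\<^sup>2)"
    by (intro mult_left_mono) auto
  moreover have "t * (t * F z) \<le> t * ((t - 1) * F x + F x')"
    using z pos by (intro mult_left_mono) auto
  ultimately show ?thesis
    unfolding scale[symmetric] by (simp add: algebra_simps power2_eq_square)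
qed

section \<open>Summation of the step inequalities\<close>

text \<open>By induction on \<open>n\<close>, the excess \<open>(t n)\<^sup>2 * (P (Suc n) + \<alpha> n * (W (Suc n) - m))\<close> of the last
  term is carried along: it is nonnegative, and it is what pays for the negative part of the
  next summand.\<close>

lemma weighted_telescoping:
  fixes P W t \<alpha> :: "nat \<Rightarrow> real"
  assumes t0: "t 0 = 1"
    and t1: "\<And>j. t j \<ge> 1"
    and t: "\<And>j. (t (Suc j))\<^sup>2 - t (Suc j) \<le> (t j)\<^sup>2"
    and \<alpha>: "\<And>j. 0 \<le> \<alpha> j" "\<And>j. \<alpha> (Suc j) \<le> \<alpha> j"
    and P: "\<And>j. P (Suc j) \<ge> 0"
    and m: "\<And>j. j \<le> n \<Longrightarrow> m \<le> W (Suc j)"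
  shows "m * (\<Sum>j\<le>n. \<alpha> j * t j)
    \<le> (\<Sum>j\<le>n. (t j)\<^sup>2 * (P (Suc j) + \<alpha> j * W (Suc j)) - ((t j)\<^sup>2 - t j) * (P j + \<alpha> j * W j))"
    (is "_ \<le> sum ?D _")
proof -
  have "(t n)\<^sup>2 * (P (Suc n) + \<alpha> n * (W (Suc n) - m)) + m * (\<Sum>j\<le>n. \<alpha> j * t j) \<le> sum ?D {..n}"
    using m
  proof (induction n)
    case 0
    then show ?case by (simp add: t0 algebra_simps)
  next
    case (Suc n)
    define c where "c = (t (Suc n))\<^sup>2 - t (Suc n)"
    have "0 \<le> t (Suc n) * (t (Suc n) - 1)"
      using t1[of "Suc n"] by simp
    then have c: "0 \<le> c" "c \<le> (t n)\<^sup>2"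
      using t[of n] by (simp_all add: c_def power2_eq_square algebra_simps)
    have "c * P (Suc n) \<le> (t n)\<^sup>2 * P (Suc n)"
      using c P by (intro mult_right_mono)
    moreover have "c * \<alpha> (Suc n) * (W (Suc n) - m) \<le> (t n)\<^sup>2 * \<alpha> n * (W (Suc n) - m)"
      using c \<alpha> Suc.prems[of n] by (intro mult_right_mono mult_mono) auto
    ultimately have "c * (P (Suc n) + \<alpha> (Suc n) * W (Suc n)) - c * \<alpha> (Suc n) * m
        \<le> (t n)\<^sup>2 * (P (Suc n) + \<alpha> n * (W (Suc n) - m))"
      by (simp add: algebra_simps)
    moreover have "(t n)\<^sup>2 * (P (Suc n) + \<alpha> n * (W (Suc n) - m)) + m * (\<Sum>j\<le>n. \<alpha> j * t j) \<le> sum ?D {..n}"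
      using Suc.IH Suc.prems by simp
    moreover have "c * \<alpha> (Suc n) * m = (t (Suc n))\<^sup>2 * \<alpha> (Suc n) * m - m * (\<alpha> (Suc n) * t (Suc n))"
      by (simp add: c_def algebra_simps)
    ultimately show ?case
      unfolding sum.atMost_Suc c_def[symmetric] by (simp add: algebra_simps)
  qed
  moreover have "0 \<le> (t n)\<^sup>2 * (P (Suc n) + \<alpha> n * (W (Suc n) - m))"
    using P[of n] \<alpha>(1)[of n] m[of n] by simp
  ultimately show ?thesis by linarith
qed

text \<open>By the mean value theorem the increment is \<open>q \<xi> powr (q - 1)\<close> with \<open>b < \<xi> < b + 1\<close>. If
  \<open>q \<ge> 1\<close>, the power increases and \<open>\<xi> \<le> b + a - 1\<close>, \<open>q \<le> a\<close> suffice. If \<open>q < 1\<close>, the power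
  decreases, and \<open>b + a - 1 \<le> a \<xi>\<close> is used instead.\<close>

lemma powr_increment_le:
  fixes a b q :: real
  assumes q: "0 < q" "q \<le> 2" and a: "a \<ge> 2" and b: "b \<ge> 1"
  shows "(b + 1) powr q - b powr q \<le> a * (b + a - 1) powr (q - 1)"
proof -
  have "\<exists>\<xi>. b < \<xi> \<and> \<xi> < b + 1 \<and> (b + 1) powr q - b powr q = (b + 1 - b) * (q * \<xi> powr (q - 1))"
    using b by (intro MVT2) (auto intro!: derivative_eq_intros)
  then obtain \<xi> where \<xi>: "b < \<xi>" "\<xi> < b + 1"
      "(b + 1) powr q - b powr q = q * \<xi> powr (q - 1)"
    by auto
  have "q * \<xi> powr (q - 1) \<le> a * (b + a - 1) powr (q - 1)"
  proof (cases "q \<ge> 1")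
    case True
    then show ?thesis
      using q a b \<xi> by (intro mult_mono powr_mono2) auto
  next
    case False
    have "0 \<le> (b - 1) * (a - 1)" using a b by simp
    also have "(b - 1) * (a - 1) = a * b - (b + a - 1)" by (simp add: algebra_simps)
    also have "a * b \<le> a * \<xi>" using a \<xi> by simp
    finally have le: "b + a - 1 \<le> a * \<xi>" by simp
    have "1 \<le> a powr q"
      using a q by (intro ge_one_powr_ge_zero) auto
    then have "q * \<xi> powr (q - 1) \<le> a powr q * \<xi> powr (q - 1)"
      using False by (intro mult_right_mono) auto
    also have "\<dots> = a * (a * \<xi>) powr (q - 1)"
      using a b \<xi> by (simp add: powr_mult powr_diff)
    also have "\<dots> \<le> a * (b + a - 1) powr (q - 1)"
      using le False a b by (intro mult_left_mono powr_mono2') auto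
    finally show ?thesis .
  qed
  with \<xi>(3) show ?thesis by simp
qed

lemma sum_powr_ge:
  fixes a q :: real
  assumes q: "0 < q" "q \<le> 2" and a: "a \<ge> 2"
  shows "(real n + 2) powr q \<le> a * (\<Sum>j\<le>n. (real j + a) powr (q - 1))"
proof (induction n)
  case 0
  have "2 powr q \<le> a powr q" using q a by (intro powr_mono2) auto
  also have "\<dots> = a * a powr (q - 1)" using a by (simp add: powr_diff)
  finally show ?case by simp
next
  case (Suc n)
  have "(real n + 3) powr q - (real n + 2) powr q \<le> a * (real n + 1 + a) powr (q - 1)"
    using powr_increment_le[OF q a, of "real n + 2"] by (simp add: algebra_simps)
  with Suc show ?case by (simp add: algebra_simps)
qed

section \<open>The regularized objective\<close>

lemma smooth_part_convex:
  assumes "convex_on UNIV f" "convex_on UNIV \<sigma>" "reg_param \<gamma> a k \<ge> 0"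
  shows "convex_on UNIV (smooth_part \<gamma> a f \<sigma> k)"
  unfolding smooth_part_def using assms by (intro convex_on_add convex_on_cmul)

lemma smooth_part_gradient:
  assumes "f differentiable (at z)" "\<sigma> differentiable (at z)"
  shows "GDERIV (smooth_part \<gamma> a f \<sigma> k) z :> gradient f z + reg_param \<gamma> a k *\<^sub>R gradient \<sigma> z"
proof -
  have "GDERIV (\<lambda>z. reg_param \<gamma> a k * \<sigma> z) z :> reg_param \<gamma> a k *\<^sub>R gradient \<sigma> z + \<sigma> z *\<^sub>R 0"
    using gradient_works[OF assms(2)] by (intro GDERIV_mult GDERIV_const)
  then show ?thesis
    unfolding smooth_part_def[abs_def] using GDERIV_add[OF gradient_works[OF assms(1)]] by simp
qed

text \<open>A regularization parameter of at most \<open>1\<close> makes the sum of the two Lipschitz constants, and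
  hence one step size, valid in every iteration.\<close>

lemma smooth_part_gradient_lipschitz:
  assumes f: "\<And>z. f differentiable (at z)" "L-lipschitz_on UNIV (gradient f)"
    and \<sigma>: "\<And>z. \<sigma> differentiable (at z)" "M-lipschitz_on UNIV (gradient \<sigma>)"
    and r: "0 \<le> reg_param \<gamma> a k" "reg_param \<gamma> a k \<le> 1"
  shows "(L + M)-lipschitz_on UNIV (gradient (smooth_part \<gamma> a f \<sigma> k))"
proof -
  have "gradient (smooth_part \<gamma> a f \<sigma> k) = (\<lambda>z. gradient f z + reg_param \<gamma> a k *\<^sub>R gradient \<sigma> z)"
    using smooth_part_gradient[OF f(1) \<sigma>(1)] by (intro ext gradient_eqI)
  moreover have "(L + 1 * M)-lipschitz_on UNIV (\<lambda>z. gradient f z + reg_param \<gamma> a k *\<^sub>R gradient \<sigma> z)"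
    using f(2) \<sigma>(2) r by (intro lipschitz_on_add lipschitz_on_cmult_upper) auto
  ultimately show ?thesis by simp
qed

lemma nonsmooth_part_not_MInfty:
  assumes "g z \<noteq> -\<infinity>" "\<psi> z \<noteq> -\<infinity>" "reg_param \<gamma> a k \<ge> 0"
  shows "nonsmooth_part \<gamma> a g \<psi> k z \<noteq> -\<infinity>"
  using assms unfolding nonsmooth_part_def
  by (cases "g z"; cases "\<psi> z"; cases "reg_param \<gamma> a k = 0") auto

lemma nonsmooth_part_finite_iff:
  assumes "g z \<noteq> -\<infinity>" "\<psi> z \<noteq> -\<infinity>" "reg_param \<gamma> a k > 0"
  shows "nonsmooth_part \<gamma> a g \<psi> k z \<noteq> \<infinity> \<longleftrightarrow> g z \<noteq> \<infinity> \<and> \<psi> z \<noteq> \<infinity>"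
  using assms unfolding nonsmooth_part_def
  by (cases "g z"; cases "\<psi> z") auto

lemma nonsmooth_part_convex:
  fixes g \<psi> :: "'a::real_vector \<Rightarrow> ereal"
  assumes g: "\<And>z. g z \<noteq> -\<infinity>" "ereal_convex g"
    and \<psi>: "\<And>z. \<psi> z \<noteq> -\<infinity>" "ereal_convex \<psi>"
    and r: "reg_param \<gamma> a k \<ge> 0"
  shows "ereal_convex (nonsmooth_part \<gamma> a g \<psi> k)"
  unfolding ereal_convex_def
proof (intro allI impI)
  fix x y :: 'a and u v :: real assume uv: "0 \<le> u" "0 \<le> v" "u + v = 1"
  define r where "r = reg_param \<gamma> a k"
  have r0: "0 \<le> r" using assms r_def by simp
  have distr: "ereal c * (A + B) = ereal c * A + ereal c * B"
    if "A \<noteq> -\<infinity>" "B \<noteq> -\<infinity>" "c \<ge> 0" for A B c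
    using that by (cases A; cases B; cases "c = 0") (auto simp: algebra_simps)
  have nm: "ereal c * A \<noteq> -\<infinity>" if "A \<noteq> -\<infinity>" "c \<ge> 0" for A c
    using that by (cases A; cases "c = 0") auto
  let ?z = "u *\<^sub>R x + v *\<^sub>R y"
  have "g ?z + ereal r * \<psi> ?z
    \<le> (ereal u * g x + ereal v * g y) + ereal r * (ereal u * \<psi> x + ereal v * \<psi> y)"
    using g(2) \<psi>(2) uv r0 unfolding ereal_convex_def
    by (intro add_mono ereal_mult_left_mono) auto
  also have "\<dots> = (ereal u * g x + ereal v * g y)
      + (ereal u * (ereal r * \<psi> x) + ereal v * (ereal r * \<psi> y))"
    using distr nm \<psi> uv r0 by (simp add: mult.left_commute)
  also have "\<dots> = ereal u * (g x + ereal r * \<psi> x) + ereal v * (g y + ereal r * \<psi> y)"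
    using distr nm g \<psi> uv r0 by (simp add: ac_simps)
  finally show "nonsmooth_part \<gamma> a g \<psi> k ?z
    \<le> ereal u * nonsmooth_part \<gamma> a g \<psi> k x + ereal v * nonsmooth_part \<gamma> a g \<psi> k y"
    unfolding nonsmooth_part_def r_def .
qed

lemma regularized_objective_split:
  assumes "\<bar>g z\<bar> \<noteq> \<infinity>" "\<bar>\<psi> z\<bar> \<noteq> \<infinity>"
  shows "smooth_part \<gamma> a f \<sigma> k z + real_of_ereal (nonsmooth_part \<gamma> a g \<psi> k z)
    = real_of_ereal (composite f g z) + reg_param \<gamma> a k * real_of_ereal (composite \<sigma> \<psi> z)"
  using assms unfolding smooth_part_def nonsmooth_part_def composite_def
  by (cases "g z"; cases "\<psi> z") (auto simp: algebra_simps)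

lemma outer_solution_finite:
  assumes g: "proper g" and \<psi>: "proper \<psi>"
    and x': "x' \<in> outer_solutions (composite f g) (composite \<sigma> \<psi>)"
  shows "\<bar>g x'\<bar> \<noteq> \<infinity>" "\<bar>\<psi> x'\<bar> \<noteq> \<infinity>"
proof -
  obtain z0 where z0: "g z0 \<noteq> \<infinity>" using g by (auto simp: proper_def)
  have "composite f g x' \<le> composite f g z0"
    using x' by (auto simp: outer_solutions_def inner_solutions_def is_arg_min_def not_less)
  then show "\<bar>g x'\<bar> \<noteq> \<infinity>"
    using z0 g by (cases "g x'"; cases "g z0") (auto simp: composite_def proper_def)
  have "\<bar>composite \<sigma> \<psi> x'\<bar> \<noteq> \<infinity>"
    using x' by (auto simp: outer_solutions_def)
  then show "\<bar>\<psi> x'\<bar> \<noteq> \<infinity>"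
    by (cases "\<psi> x'") (auto simp: composite_def)
qed

section \<open>Convergence rate for the outer problem\<close>

theorem theorem2:
  fixes f \<sigma> :: "real ^ 'n \<Rightarrow> real"
    and g \<psi> :: "real ^ 'n \<Rightarrow> ereal"
    and \<phi> \<omega> :: "real ^ 'n \<Rightarrow> ereal"
    and \<beta>\<^sub>f \<beta>\<^sub>\<sigma> \<beta> \<gamma> :: real
    and a k :: int
    and x y :: "int \<Rightarrow> real ^ 'n"
    and x' :: "real ^ 'n"
  assumes "convex_on UNIV f" and "convex_on UNIV \<sigma>"
    and "continuously_differentiable f" and "continuously_differentiable \<sigma>"
    and "\<beta>\<^sub>f-lipschitz_on UNIV (gradient f)" and "\<beta>\<^sub>\<sigma>-lipschitz_on UNIV (gradient \<sigma>)"
    and "\<beta> = \<beta>\<^sub>f + \<beta>\<^sub>\<sigma>" and "\<beta> > 0"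
    and "proper g" and "lower_semicontinuous g" and "ereal_convex g"
    and "proper \<psi>" and "lower_semicontinuous \<psi>" and "ereal_convex \<psi>"
    and "\<phi> = composite f g" and "\<omega> = composite \<sigma> \<psi>"
    and "inner_solutions \<phi> \<noteq> {}"
    and "(INF z. \<omega> z) > -\<infinity>"
    and "0 < \<gamma>" and "\<gamma> < 2" and "a \<ge> 2"
    and "FBi_PG \<beta> \<gamma> a f g \<sigma> \<psi> x y"
    and "k \<ge> 1" and "x' \<in> outer_solutions \<phi> \<omega>"
  shows "(MIN s\<in>{1..k}. \<omega> (x s)) - \<omega> x'
    \<le> ereal ((real_of_int a)\<^sup>2 * \<beta> / (2 * real_of_int (k + 1) powr (2 - \<gamma>)) * (norm (x 0 - x'))\<^sup>2)"
proof -
  \<comment> \<open>The starting point may have infinite objective values. Then \<open>\<Phi> 0\<close> and \<open>\<Omega> 0\<close> are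
    meaningless numbers, but they only occur with the factor \<open>(t 0)\<^sup>2 - t 0 = 0\<close>.\<close>
  define \<Phi> where "\<Phi> s = real_of_ereal (\<phi> (x s)) - real_of_ereal (\<phi> x')" for s
  define \<Omega> where "\<Omega> s = real_of_ereal (\<omega> (x s)) - real_of_ereal (\<omega> x')" for s
  define t where "t j = (real j + real_of_int a) / real_of_int a" for j
  define \<alpha> where "\<alpha> j = (real j + real_of_int a) powr (- \<gamma>)" for j
  \<comment> \<open>The FISTA potential; index \<open>-1\<close> has momentum \<open>0\<close>, which reduces \<open>E 0\<close> to the squared distance
    of \<open>x (-1) = x 0\<close> from \<open>x'\<close>.\<close>
  define E where "E j = (norm (momentum a (int j - 1) *\<^sub>R x (int j)
      - (momentum a (int j - 1) - 1) *\<^sub>R x (int j - 1) - x'))\<^sup>2" for j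
  have a: "real_of_int a \<ge> 2" using \<open>a \<ge> 2\<close> by simp
  have diff: "f differentiable (at z)" "\<sigma> differentiable (at z)" for z
    using assms(3,4) by (auto simp: continuously_differentiable_def)
  have not_MInfty: "g z \<noteq> -\<infinity>" "\<psi> z \<noteq> -\<infinity>" for z
    using \<open>proper g\<close> \<open>proper \<psi>\<close> by (auto simp: proper_def)
  have fin': "\<bar>g x'\<bar> \<noteq> \<infinity>" "\<bar>\<psi> x'\<bar> \<noteq> \<infinity>"
    using outer_solution_finite[OF \<open>proper g\<close> \<open>proper \<psi>\<close>, of x' f \<sigma>]
      \<open>x' \<in> outer_solutions \<phi> \<omega>\<close> \<open>\<phi> = composite f g\<close> \<open>\<omega> = composite \<sigma> \<psi>\<close> by simp_all
  have reg: "reg_param \<gamma> a (int j) = \<alpha> j" for j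
    by (simp add: reg_param_def \<alpha>_def)
  have mom: "momentum a (int j) = t j" for j
    by (simp add: momentum_def t_def)
  have \<alpha>_pos: "0 < \<alpha> j" for j
    using a by (simp add: \<alpha>_def)
  have \<alpha>_le: "\<alpha> j \<le> 1" for j
    using powr_mono[of "- \<gamma>" 0 "real j + real_of_int a"] a \<open>0 < \<gamma>\<close> by (simp add: \<alpha>_def)
  have t_ge: "t j \<ge> 1" for j
    using a by (simp add: t_def)
  have pmin: "is_arg_min (\<lambda>z. nonsmooth_part \<gamma> a g \<psi> (int j) z
        + ereal (z \<bullet> gradient (smooth_part \<gamma> a f \<sigma> (int j)) (y (int j)) + \<beta> / 2 * (norm (z - y (int j)))\<^sup>2))
      (\<lambda>_. True) (x (int (Suc j)))" for j
  proof -
    have "is_arg_min (\<lambda>z. nonsmooth_part \<gamma> a g \<psi> (int j) z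
        + ereal (z \<bullet> gradient (smooth_part \<gamma> a f \<sigma> (int j)) (y (int j)) + \<beta> / 2 * (norm (z - y (int j)))\<^sup>2))
      (\<lambda>_. True) (x (int j + 1))"
      using \<open>FBi_PG \<beta> \<gamma> a f g \<sigma> \<psi> x y\<close> of_nat_0_le_iff[of j] unfolding FBi_PG_def by blast
    then show ?thesis by (simp only: of_nat_Suc add.commute)
  qed
  have p_cvx: "ereal_convex (nonsmooth_part \<gamma> a g \<psi> (int j))" for j
    using \<open>ereal_convex g\<close> \<open>ereal_convex \<psi>\<close> not_MInfty \<alpha>_pos[of j]
    by (intro nonsmooth_part_convex) (auto simp: reg)
  have p_not_MInfty: "nonsmooth_part \<gamma> a g \<psi> (int j) z \<noteq> -\<infinity>" for j z
    using not_MInfty \<alpha>_pos[of j] by (intro nonsmooth_part_not_MInfty) (auto simp: reg)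
  have p_fin: "nonsmooth_part \<gamma> a g \<psi> (int j) z \<noteq> \<infinity> \<longleftrightarrow> g z \<noteq> \<infinity> \<and> \<psi> z \<noteq> \<infinity>" for j z
    using not_MInfty \<alpha>_pos[of j] by (intro nonsmooth_part_finite_iff) (auto simp: reg)
  have p_fin': "nonsmooth_part \<gamma> a g \<psi> (int j) x' \<noteq> \<infinity>" for j
    using fin' by (auto simp: p_fin)
  have "nonsmooth_part \<gamma> a g \<psi> (int j) (x (int (Suc j))) \<noteq> \<infinity>" for j
    by (rule prox_three_point(1)[OF p_cvx p_not_MInfty pmin p_fin'])
  then have fin: "\<bar>g (x (int (Suc j)))\<bar> \<noteq> \<infinity>" "\<bar>\<psi> (x (int (Suc j)))\<bar> \<noteq> \<infinity>" for j
    using not_MInfty p_fin by auto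

  have step: "(t j)\<^sup>2 * (\<Phi> (int (Suc j)) + \<alpha> j * \<Omega> (int (Suc j)))
      - ((t j)\<^sup>2 - t j) * (\<Phi> (int j) + \<alpha> j * \<Omega> (int j)) \<le> \<beta> / 2 * (E j - E (Suc j))" for j
  proof -
    define F where "F z = smooth_part \<gamma> a f \<sigma> (int j) z
      + real_of_ereal (nonsmooth_part \<gamma> a g \<psi> (int j) z)" for z
    have F: "F z - F x' = real_of_ereal (\<phi> z) - real_of_ereal (\<phi> x')
        + \<alpha> j * (real_of_ereal (\<omega> z) - real_of_ereal (\<omega> x'))"
      if "\<bar>g z\<bar> \<noteq> \<infinity>" "\<bar>\<psi> z\<bar> \<noteq> \<infinity>" for z
      using regularized_objective_split[where \<gamma> = \<gamma> and a = a and f = f and \<sigma> = \<sigma> and k = "int j"] that fin'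
      by (simp add: F_def \<open>\<phi> = composite f g\<close> \<open>\<omega> = composite \<sigma> \<psi>\<close> reg algebra_simps)
    have "GDERIV (smooth_part \<gamma> a f \<sigma> (int j)) z :> gradient (smooth_part \<gamma> a f \<sigma> (int j)) z" for z
      using smooth_part_gradient[OF diff] gradient_eqI by metis
    moreover have "\<beta>-lipschitz_on UNIV (gradient (smooth_part \<gamma> a f \<sigma> (int j)))"
      unfolding \<open>\<beta> = \<beta>\<^sub>f + \<beta>\<^sub>\<sigma>\<close> using assms(5,6) diff \<alpha>_pos[of j] \<alpha>_le[of j]
      by (intro smooth_part_gradient_lipschitz) (auto simp: reg)
    moreover have "convex_on UNIV (smooth_part \<gamma> a f \<sigma> (int j))"
      using assms(1,2) \<alpha>_pos[of j] by (intro smooth_part_convex) (auto simp: reg)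
    moreover have "t j = 1 \<or> nonsmooth_part \<gamma> a g \<psi> (int j) (x (int j)) \<noteq> \<infinity>"
    proof (cases j)
      case 0
      then show ?thesis using a by (simp add: t_def)
    next
      case (Suc i)
      then show ?thesis using fin[of i] p_fin[of j "x (int j)"] by auto
    qed
    ultimately have "(t j)\<^sup>2 * (F (x (int (Suc j))) - F x') - ((t j)\<^sup>2 - t j) * (F (x (int j)) - F x')
      \<le> \<beta> / 2 * ((norm (t j *\<^sub>R y (int j) - (t j - 1) *\<^sub>R x (int j) - x'))\<^sup>2
        - (norm (t j *\<^sub>R x (int (Suc j)) - (t j - 1) *\<^sub>R x (int j) - x'))\<^sup>2)"
      unfolding F_def
      by (intro accelerated_step[where G = "gradient (smooth_part \<gamma> a f \<sigma> (int j))"]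
          p_cvx p_not_MInfty pmin t_ge p_fin')
    moreover have "((t j)\<^sup>2 - t j) * (F (x (int j)) - F x')
        = ((t j)\<^sup>2 - t j) * (\<Phi> (int j) + \<alpha> j * \<Omega> (int j))"
    proof (cases j)
      case 0
      then show ?thesis using a by (simp add: t_def)
    next
      case (Suc i)
      then show ?thesis using F[OF fin[of i]] by (simp add: \<Phi>_def \<Omega>_def)
    qed
    \<comment> \<open>The extrapolation is chosen so that the potential at \<open>y\<^sub>j\<close> is the one left by step \<open>j - 1\<close>.\<close>
    moreover have "t j *\<^sub>R y (int j) - (t j - 1) *\<^sub>R x (int j) - x' = momentum a (int j - 1) *\<^sub>R x (int j)
      - (momentum a (int j - 1) - 1) *\<^sub>R x (int j - 1) - x'"
    proof -
      have "y (int j) = x (int j)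
          + (inverse (t j) * (momentum a (int j - 1) - 1)) *\<^sub>R (x (int j) - x (int j - 1))"
        using \<open>FBi_PG \<beta> \<gamma> a f g \<sigma> \<psi> x y\<close> unfolding FBi_PG_def by (simp add: mom)
      then have "t j *\<^sub>R y (int j) = t j *\<^sub>R x (int j)
          + (momentum a (int j - 1) - 1) *\<^sub>R (x (int j) - x (int j - 1))"
        using t_ge[of j] by (simp add: scaleR_add_right)
      then show ?thesis by (simp add: algebra_simps)
    qed
    ultimately show ?thesis
      using F[OF fin[of j]] by (simp add: E_def \<Phi>_def \<Omega>_def mom)
  qed

  have "(MIN s\<in>{1..k}. \<omega> (x s)) \<in> (\<lambda>s. \<omega> (x s)) ` {1..k}"
    using \<open>k \<ge> 1\<close> by (intro Min_in) auto
  then obtain s0 where s0: "1 \<le> s0" "s0 \<le> k" "(MIN s\<in>{1..k}. \<omega> (x s)) = \<omega> (x s0)"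
    by auto
  have \<omega>_real: "\<omega> (x (int (Suc j))) = ereal (real_of_ereal (\<omega> (x (int (Suc j)))))" for j
    using fin[of j] by (cases "\<psi> (x (int (Suc j)))") (auto simp: \<open>\<omega> = composite \<sigma> \<psi>\<close> composite_def)
  have \<omega>'_real: "\<omega> x' = ereal (real_of_ereal (\<omega> x'))"
    using fin' by (cases "\<psi> x'") (auto simp: \<open>\<omega> = composite \<sigma> \<psi>\<close> composite_def)
  have s0_eq: "s0 = int (Suc (nat (s0 - 1)))" using s0 by simp
  \<comment> \<open>The iterates \<open>x 1, \<dots>, x k\<close> are produced by the steps \<open>0, \<dots>, n\<close>.\<close>
  define n where "n = nat (k - 1)"
  have n: "k = int n + 1" using \<open>k \<ge> 1\<close> by (simp add: n_def)
  have best: "\<Omega> s0 \<le> \<Omega> (int (Suc j))" if "j \<le> n" for j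
  proof -
    have "\<omega> (x s0) \<le> \<omega> (x (int (Suc j)))"
      unfolding s0(3)[symmetric] using that n by (intro Min_le) auto
    then show ?thesis
      using \<omega>_real[of j] \<omega>_real[of "nat (s0 - 1)"] s0_eq unfolding \<Omega>_def
      by (metis diff_right_mono ereal_less_eq(3))
  qed
  have "0 \<le> \<Phi> (int (Suc j))" for j
  proof -
    have "\<phi> x' \<le> \<phi> (x (int (Suc j)))"
      using \<open>x' \<in> outer_solutions \<phi> \<omega>\<close>
      by (auto simp: outer_solutions_def inner_solutions_def is_arg_min_def not_less)
    then show ?thesis
      using fin[of j] fin' unfolding \<Phi>_def
      by (cases "g x'"; cases "g (x (int (Suc j)))") (auto simp: \<open>\<phi> = composite f g\<close> composite_def)
  qed
  moreover have "\<alpha> (Suc j) \<le> \<alpha> j" for j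
    using a \<open>0 < \<gamma>\<close> unfolding \<alpha>_def by (intro powr_mono2') auto
  moreover have "(t (Suc j))\<^sup>2 - t (Suc j) \<le> (t j)\<^sup>2" for j
  proof -
    define b where "b = real_of_int a"
    have b: "b \<ge> 2" using a b_def by simp
    have "0 \<le> real j * (b - 2) + (b * (b - 1) - 1)"
      using b mult_mono[of 2 b 1 "b - 1"] by simp
    have "(t j)\<^sup>2 - ((t (Suc j))\<^sup>2 - t (Suc j)) = (real j * (b - 2) + (b * (b - 1) - 1)) / b\<^sup>2"
      using b by (simp add: t_def b_def[symmetric] power2_eq_square field_simps)
    also have "\<dots> \<ge> 0" by (rule divide_nonneg_nonneg) (fact, simp)
    finally show ?thesis by simp
  qed
  moreover have "t 0 = 1" using a by (simp add: t_def)
  ultimately have "\<Omega> s0 * (\<Sum>j\<le>n. \<alpha> j * t j)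
      \<le> (\<Sum>j\<le>n. (t j)\<^sup>2 * (\<Phi> (int (Suc j)) + \<alpha> j * \<Omega> (int (Suc j)))
          - ((t j)\<^sup>2 - t j) * (\<Phi> (int j) + \<alpha> j * \<Omega> (int j)))"
    using t_ge \<alpha>_pos best
    by (intro weighted_telescoping[where P = "\<lambda>j. \<Phi> (int j)" and W = "\<lambda>j. \<Omega> (int j)"])
      (auto simp: less_imp_le)
  also have "\<dots> \<le> (\<Sum>j\<le>n. \<beta> / 2 * (E j - E (Suc j)))"
    by (intro sum_mono step)
  also have "\<dots> = \<beta> / 2 * (E 0 - E (Suc n))"
    by (simp only: sum_distrib_left[symmetric] sum_telescope)
  also have "\<dots> \<le> \<beta> / 2 * E 0"
    using \<open>\<beta> > 0\<close> by (simp add: E_def)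
  also have "E 0 = (norm (x 0 - x'))\<^sup>2"
    using \<open>FBi_PG \<beta> \<gamma> a f g \<sigma> \<psi> x y\<close> by (simp add: E_def momentum_def FBi_PG_def)
  finally have weighted: "\<Omega> s0 * (\<Sum>j\<le>n. \<alpha> j * t j) \<le> \<beta> / 2 * (norm (x 0 - x'))\<^sup>2" .

  define K where "K = real_of_int (k + 1) powr (2 - \<gamma>)"
  have "K > 0" using \<open>k \<ge> 1\<close> by (simp add: K_def)
  have "\<alpha> j * t j = (real j + real_of_int a) powr (2 - \<gamma> - 1) / real_of_int a" for j
    using a by (simp add: \<alpha>_def t_def powr_diff powr_minus field_simps power2_eq_square)
  then have "K \<le> (real_of_int a)\<^sup>2 * (\<Sum>j\<le>n. \<alpha> j * t j)"
    using sum_powr_ge[of "2 - \<gamma>" "real_of_int a" n] \<open>0 < \<gamma>\<close> \<open>\<gamma> < 2\<close> a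
    by (simp add: K_def n sum_divide_distrib[symmetric] power2_eq_square algebra_simps)
  have "\<Omega> s0 * K \<le> (real_of_int a)\<^sup>2 * (\<beta> / 2 * (norm (x 0 - x'))\<^sup>2)"
  proof (cases "\<Omega> s0 \<ge> 0")
    case True
    then have "\<Omega> s0 * K \<le> \<Omega> s0 * ((real_of_int a)\<^sup>2 * (\<Sum>j\<le>n. \<alpha> j * t j))"
      using \<open>K \<le> _\<close> by (intro mult_left_mono)
    also have "\<dots> = (real_of_int a)\<^sup>2 * (\<Omega> s0 * (\<Sum>j\<le>n. \<alpha> j * t j))"
      by (simp add: mult_ac)
    also have "\<dots> \<le> (real_of_int a)\<^sup>2 * (\<beta> / 2 * (norm (x 0 - x'))\<^sup>2)"
      using weighted by (intro mult_left_mono) auto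
    finally show ?thesis .
  next
    case False
    then have "\<Omega> s0 * K \<le> 0" using \<open>K > 0\<close> by (simp add: mult_nonpos_nonneg)
    also have "0 \<le> (real_of_int a)\<^sup>2 * (\<beta> / 2 * (norm (x 0 - x'))\<^sup>2)" using \<open>\<beta> > 0\<close> by simp
    finally show ?thesis .
  qed
  then have "\<Omega> s0 \<le> (real_of_int a)\<^sup>2 * \<beta> / (2 * K) * (norm (x 0 - x'))\<^sup>2"
    using \<open>K > 0\<close> by (simp add: field_simps)
  moreover have "\<omega> (x s0) - \<omega> x' = ereal (\<Omega> s0)"
    using \<omega>_real[of "nat (s0 - 1)"] \<omega>'_real s0_eq unfolding \<Omega>_def by (metis ereal_minus(1))
  ultimately show ?thesis
    unfolding s0(3) K_def by simp
qed

end
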